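(* Let $b\ge2$ and let $U^1,\dots,U^b$ be tree topologies on disjoint node sets. Let $U$ be the tree obtained from their disjoint union by adding a new node $r$ and connecting $r$ by an edge to one node of each $U^i$. Then for every choice of vertices $P^1,\dots,P^b$, where $P^i$ is a vertex of the polyhedron of the STT LP for $U^i$, there is a vertex $P$ of the polyhedron of the STT LP for $U$ whose projection onto the variables related only to $U^i$ (the variables $X_{uv}$ and $Z_{kuv}$ with $u,v,k\in U^i$) equals the corresponding coordinates of $P^i$, for every $i$.
   Context: For a tree $U$ and distinct nodes $i,j$, $(i\leftrightsquigarrow j)$ denotes the nodes strictly between $i$ and $j$ on the $U$-path. The STT LP for $U$ has variables $D_i$ ($i\in U$), $X_{ij}$ ($i\ne j$), $Z_{kij}=Z_{kji}$ ($k\in(i\leftrightsquigarrow j)$); constraints $X_{ij}\ge0$, $Z_{kij}\ge0$; for all $i\ne j$: $X_{ij}+X_{ji}+\sum_{k\in(i\leftrightsquigarrow j)}Z_{kij}\ge1$; $Z_{kij}\le X_{ki}$, $Z_{kij}\le X_{kj}$; $D_i\ge\sum_{j\ne i}X_{ji}$. *)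

theory Defs
  imports "HOL-Analysis.Analysis" "HOL-Analysis.Finite_Function_Topology"
begin

record 'a ugraph =
  nodes :: "'a set"
  edges :: "'a set set"

definition adj :: "'a ugraph \<Rightarrow> 'a \<Rightarrow> 'a \<Rightarrow> bool" where
  "adj U u v \<longleftrightarrow> {u, v} \<in> edges U"

definition simple_ugraph :: "'a ugraph \<Rightarrow> bool" where
  "simple_ugraph U \<longleftrightarrow>
     finite (nodes U) \<and>
     edges U \<subseteq> {{u, v} | u v. u \<in> nodes U \<and> v \<in> nodes U \<and> u \<noteq> v}"

definition is_path :: "'a ugraph \<Rightarrow> 'a \<Rightarrow> 'a list \<Rightarrow> 'a \<Rightarrow> bool" where
  "is_path U u p v \<longleftrightarrow>
     p \<noteq> [] \<and> hd p = u \<and> last p = v \<and> distinct p \<and> set p \<subseteq> nodes U \<and> successively (adj U) p"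

definition is_cycle :: "'a ugraph \<Rightarrow> 'a list \<Rightarrow> bool" where
  "is_cycle U p \<longleftrightarrow>
     length p \<ge> 3 \<and> distinct p \<and> set p \<subseteq> nodes U \<and> successively (adj U) p \<and>
     adj U (last p) (hd p)"

definition connected_ugraph :: "'a ugraph \<Rightarrow> bool" where
  "connected_ugraph U \<longleftrightarrow>
     nodes U \<noteq> {} \<and> (\<forall>u\<in>nodes U. \<forall>v\<in>nodes U. \<exists>p. is_path U u p v)"

definition is_tree :: "'a ugraph \<Rightarrow> bool" where
  "is_tree U \<longleftrightarrow> simple_ugraph U \<and> connected_ugraph U \<and> (\<nexists>p. is_cycle U p)"

definition path_between :: "'a ugraph \<Rightarrow> 'a \<Rightarrow> 'a \<Rightarrow> 'a set" where
  "path_between U i j = {k. k \<noteq> i \<and> k \<noteq> j \<and> (\<exists>p. is_path U i p j \<and> k \<in> set p)}"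

definition join_trees :: "'a \<Rightarrow> nat \<Rightarrow> (nat \<Rightarrow> 'a ugraph) \<Rightarrow> (nat \<Rightarrow> 'a) \<Rightarrow> 'a ugraph" where
  "join_trees r b U c =
     \<lparr> nodes = insert r (\<Union>i\<in>{1..b}. nodes (U i)),
       edges = (\<Union>i\<in>{1..b}. edges (U i)) \<union> (\<lambda>i. {r, c i}) ` {1..b} \<rparr>"

text \<open>
  The variable with indices \<open>k, i, j\<close> of the third kind is \<open>Zvar k {i, j}\<close>; the unordered pair
  makes the variables \<open>Z\<close> with indices \<open>k, i, j\<close> and \<open>k, j, i\<close> literally the same.
\<close>

datatype 'a stt_var = Dvar 'a | Xvar 'a 'a | Zvar 'a "'a set"

definition stt_vars :: "'a ugraph \<Rightarrow> 'a stt_var set" where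
  "stt_vars U =
     {Dvar i | i. i \<in> nodes U} \<union>
     {Xvar i j | i j. i \<in> nodes U \<and> j \<in> nodes U \<and> i \<noteq> j} \<union>
     {Zvar k {i, j} | k i j. i \<in> nodes U \<and> j \<in> nodes U \<and> i \<noteq> j \<and> k \<in> path_between U i j}"

text \<open>
  The coordinate space of the LP for \<open>U\<close> is the space of real functions on \<open>stt_vars U\<close>,
  represented by finitely supported functions that vanish outside \<open>stt_vars U\<close>.
\<close>

definition stt_polyhedron :: "'a ugraph \<Rightarrow> ('a stt_var, real) poly_mapping set" where
  "stt_polyhedron U = {P.
     Poly_Mapping.keys P \<subseteq> stt_vars U \<and>
     (\<forall>i\<in>nodes U. \<forall>j\<in>nodes U. i \<noteq> j \<longrightarrow>
        Poly_Mapping.lookup P (Xvar i j) \<ge> 0 \<and>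
        Poly_Mapping.lookup P (Xvar i j) + Poly_Mapping.lookup P (Xvar j i)
          + (\<Sum>k\<in>path_between U i j. Poly_Mapping.lookup P (Zvar k {i, j})) \<ge> 1 \<and>
        (\<forall>k\<in>path_between U i j.
           Poly_Mapping.lookup P (Zvar k {i, j}) \<ge> 0 \<and>
           Poly_Mapping.lookup P (Zvar k {i, j}) \<le> Poly_Mapping.lookup P (Xvar k i) \<and>
           Poly_Mapping.lookup P (Zvar k {i, j}) \<le> Poly_Mapping.lookup P (Xvar k j))) \<and>
     (\<forall>i\<in>nodes U.
        Poly_Mapping.lookup P (Dvar i) \<ge> (\<Sum>j\<in>nodes U - {i}. Poly_Mapping.lookup P (Xvar j i)))}"

end

theory Submission
  imports Defs
begin

text \<open>
  Make \<open>r\<close> the root: put \<open>X\<^sub>r\<^sub>v = 1\<close> for every other node \<open>v\<close>, put \<open>Z\<^sub>r\<^sub>u\<^sub>v = 1\<close> whenever \<open>u\<close> and \<open>v\<close> lie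
  in different components, let every other variable that mixes components or involves \<open>r\<close> be \<open>0\<close>,
  and raise each \<open>D\<^sub>v\<close> by \<open>1\<close>.  If the resulting point lies on a segment inside the polyhedron,
  the vanishing coordinates vanish along the segment, which forces the coordinates that equal
  \<open>1\<close>; subtracting the shift and restricting to a component then gives a segment inside the
  polyhedron of that component through the given vertex, which must be trivial.
\<close>

section \<open>Walks, LP variables and constraints\<close>

lemma successively_invariant:
  assumes "successively R p" "\<And>x y. x \<in> set p \<Longrightarrow> y \<in> set p \<Longrightarrow> R x y \<Longrightarrow> A x \<longleftrightarrow> A y"
    and "x \<in> set p" "y \<in> set p"
  shows "A x \<longleftrightarrow> A y"
proof -
  have "\<forall>x\<in>set p. A x \<longleftrightarrow> A (hd p)"
    using assms(1,2)
  proof (induction p rule: induct_list012)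
    case (3 a a' p)
    then have "\<forall>x\<in>set (a' # p). A x \<longleftrightarrow> A a'" "A a \<longleftrightarrow> A a'"
      by simp_all
    then show ?case by simp
  qed simp_all
  then show ?thesis using assms(3,4) by blast
qed

lemma path_between_subset_nodes: "path_between G u v \<subseteq> nodes G"
  by (auto simp: path_between_def is_path_def)

lemma adj_sym: "adj G u v \<longleftrightarrow> adj G v u"
  by (simp add: adj_def insert_commute)

lemma simple_ugraph_adjD:
  "simple_ugraph G \<Longrightarrow> adj G u v \<Longrightarrow> u \<in> nodes G \<and> v \<in> nodes G \<and> u \<noteq> v"
  by (fastforce simp: simple_ugraph_def adj_def doubleton_eq_iff)

lemma finite_path_between: "finite (nodes G) \<Longrightarrow> finite (path_between G u v)"
  by (rule finite_subset[OF path_between_subset_nodes])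

lemma stt_vars_iff [simp]:
  "Dvar v \<in> stt_vars G \<longleftrightarrow> v \<in> nodes G"
  "Xvar u v \<in> stt_vars G \<longleftrightarrow> u \<in> nodes G \<and> v \<in> nodes G \<and> u \<noteq> v"
  by (auto simp: stt_vars_def)

lemma Zvar_in_stt_vars:
  "u \<in> nodes G \<Longrightarrow> v \<in> nodes G \<Longrightarrow> u \<noteq> v \<Longrightarrow> k \<in> path_between G u v \<Longrightarrow> Zvar k {u, v} \<in> stt_vars G"
  unfolding stt_vars_def by blast

lemma Zvar_in_stt_varsE:
  assumes "Zvar k e \<in> stt_vars G"
  obtains u v where "e = {u, v}" "u \<in> nodes G" "v \<in> nodes G" "u \<noteq> v" "k \<in> path_between G u v"
  using assms by (auto simp: stt_vars_def)

lemma Zvar_in_stt_vars_subset: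
  assumes "Zvar k e \<in> stt_vars G"
  shows "k \<in> nodes G" "e \<subseteq> nodes G" "e \<noteq> {}"
  using assms path_between_subset_nodes[of G] by (auto elim!: Zvar_in_stt_varsE)

lemma finite_stt_vars:
  assumes "finite (nodes G)"
  shows "finite (stt_vars G)"
proof -
  let ?N = "nodes G"
  \<comment> \<open>A crude finite superset is enough: the pair of a \<open>Z\<close> variable is
    remembered only as some set of nodes.\<close>
  have "x \<in> Dvar ` ?N \<union> case_prod Xvar ` (?N \<times> ?N) \<union> case_prod Zvar ` (?N \<times> Pow ?N)"
    if "x \<in> stt_vars G" for x
    using that Zvar_in_stt_vars_subset[of _ _ G] by (cases x) (auto simp: image_iff)
  then have "stt_vars G \<subseteq> Dvar ` ?N \<union> case_prod Xvar ` (?N \<times> ?N) \<union> case_prod Zvar ` (?N \<times> Pow ?N)"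
    by blast
  then show ?thesis
    by (rule finite_subset) (use assms in auto)
qed

lemma stt_polyhedronD:
  assumes "P \<in> stt_polyhedron G"
  shows "Poly_Mapping.keys P \<subseteq> stt_vars G"
    and "v \<in> nodes G \<Longrightarrow>
      (\<Sum>j\<in>nodes G - {v}. Poly_Mapping.lookup P (Xvar j v)) \<le> Poly_Mapping.lookup P (Dvar v)"
    and "u \<in> nodes G \<Longrightarrow> v \<in> nodes G \<Longrightarrow> u \<noteq> v \<Longrightarrow> 0 \<le> Poly_Mapping.lookup P (Xvar u v)"
    and "u \<in> nodes G \<Longrightarrow> v \<in> nodes G \<Longrightarrow> u \<noteq> v \<Longrightarrow>
      1 \<le> Poly_Mapping.lookup P (Xvar u v) + Poly_Mapping.lookup P (Xvar v u)
        + (\<Sum>k\<in>path_between G u v. Poly_Mapping.lookup P (Zvar k {u, v}))"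
    and "u \<in> nodes G \<Longrightarrow> v \<in> nodes G \<Longrightarrow> u \<noteq> v \<Longrightarrow> k \<in> path_between G u v \<Longrightarrow>
      0 \<le> Poly_Mapping.lookup P (Zvar k {u, v})"
    and "u \<in> nodes G \<Longrightarrow> v \<in> nodes G \<Longrightarrow> u \<noteq> v \<Longrightarrow> k \<in> path_between G u v \<Longrightarrow>
      Poly_Mapping.lookup P (Zvar k {u, v}) \<le> Poly_Mapping.lookup P (Xvar k u)"
    and "u \<in> nodes G \<Longrightarrow> v \<in> nodes G \<Longrightarrow> u \<noteq> v \<Longrightarrow> k \<in> path_between G u v \<Longrightarrow>
      Poly_Mapping.lookup P (Zvar k {u, v}) \<le> Poly_Mapping.lookup P (Xvar k v)"
  using assms by (simp_all add: stt_polyhedron_def)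

section \<open>Finitely supported functions and convex combinations\<close>

definition pm_on :: "'v set \<Rightarrow> ('v \<Rightarrow> real) \<Rightarrow> ('v, real) poly_mapping" where
  "pm_on S f = Abs_poly_mapping (\<lambda>x. if x \<in> S then f x else 0)"

lemma lookup_pm_on:
  assumes "finite S"
  shows "Poly_Mapping.lookup (pm_on S f) x = (if x \<in> S then f x else 0)"
proof -
  have "finite {x. (if x \<in> S then f x else 0) \<noteq> 0}"
    by (rule finite_subset[OF _ assms]) auto
  then show ?thesis
    by (simp add: pm_on_def)
qed

lemma lookup_scaleR [simp]:
  fixes P :: "('v, real) poly_mapping"
  shows "Poly_Mapping.lookup (t *\<^sub>R P) x = t * Poly_Mapping.lookup P x"
proof -
  have "finite {x. t * Poly_Mapping.lookup P x \<noteq> 0}"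
    by (rule finite_subset[OF _ finite_lookup[of P]]) auto
  then show ?thesis by (simp add: scaleR_poly_mapping_def)
qed

lemma keys_subset_iff: "Poly_Mapping.keys P \<subseteq> S \<longleftrightarrow> (\<forall>x. x \<notin> S \<longrightarrow> Poly_Mapping.lookup P x = 0)"
  by (auto simp: in_keys_iff)

text \<open>An open segment has distinct endpoints by definition, so avoiding all open segments
  means that every proper convex combination has equal endpoints. This form serves both to exploit
  the extremality of each \<open>Q i\<close> and to prove that of the glued point.\<close>

lemma extreme_point_of_convex_combination_iff:
  fixes x :: "'v::real_vector"
  shows "x extreme_point_of S \<longleftrightarrow> x \<in> S \<and>
    (\<forall>a\<in>S. \<forall>b\<in>S. \<forall>t. 0 < t \<and> t < 1 \<and> x = (1 - t) *\<^sub>R a + t *\<^sub>R b \<longrightarrow> a = b)"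
  unfolding extreme_point_of_def in_segment by blast

text \<open>The deviations \<open>a - m\<close> and \<open>b - m\<close> are nonnegative and a
  combination of them with positive weights vanishes, so both vanish. Applied to single coordinates,
  it freezes those that attain a bound in the interior of a segment.\<close>

lemma convex_combination_lower_bound_tight:
  fixes a b t m :: real
  assumes "(1 - t) * a + t * b = m" "0 < t" "t < 1" "m \<le> a" "m \<le> b"
  shows "a = m" "b = m"
proof -
  have "(1 - t) * (a - m) + t * (b - m) = 0"
    using assms(1) by (simp add: algebra_simps)
  moreover have "0 \<le> (1 - t) * (a - m)" "0 \<le> t * (b - m)"
    using assms by simp_all
  ultimately have "(1 - t) * (a - m) = 0" "t * (b - m) = 0"
    by linarith+
  then show "a = m" "b = m"
    using assms by auto
qed

lemma convex_combination_upper_bound_tight: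
  fixes a b t m :: real
  assumes "(1 - t) * a + t * b = m" "0 < t" "t < 1" "a \<le> m" "b \<le> m"
  shows "a = m" "b = m"
  using convex_combination_lower_bound_tight[of t "- a" "- b" "- m"] assms by auto

section \<open>The joined graph: adjacency and paths\<close>

locale tree_join =
  fixes r :: 'a and b :: nat and U :: "nat \<Rightarrow> 'a ugraph" and c :: "nat \<Rightarrow> 'a"
  assumes simple: "\<And>i. i \<in> {1..b} \<Longrightarrow> simple_ugraph (U i)"
    and connected: "\<And>i. i \<in> {1..b} \<Longrightarrow> connected_ugraph (U i)"
    and disjoint: "disjoint_family_on (\<lambda>i. nodes (U i)) {1..b}"
    and root_fresh: "\<And>i. i \<in> {1..b} \<Longrightarrow> r \<notin> nodes (U i)"
    and attach: "\<And>i. i \<in> {1..b} \<Longrightarrow> c i \<in> nodes (U i)"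
begin

abbreviation "J \<equiv> join_trees r b U c"

lemma nodes_J: "nodes J = insert r (\<Union>i\<in>{1..b}. nodes (U i))"
  by (simp add: join_trees_def)

lemma component_node: "i \<in> {1..b} \<Longrightarrow> v \<in> nodes (U i) \<Longrightarrow> v \<in> nodes J"
  by (auto simp: nodes_J)

lemma finite_nodes_component: "i \<in> {1..b} \<Longrightarrow> finite (nodes (U i))"
  using simple by (simp add: simple_ugraph_def)

lemma finite_nodes_J: "finite (nodes J)"
  using finite_nodes_component by (auto simp: nodes_J)

lemma component_unique:
  "v \<in> nodes (U i) \<Longrightarrow> v \<in> nodes (U j) \<Longrightarrow> i \<in> {1..b} \<Longrightarrow> j \<in> {1..b} \<Longrightarrow> i = j"
  using disjoint unfolding disjoint_family_on_def by blast

lemma adj_J_iff: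
  "adj J u v \<longleftrightarrow> (\<exists>i\<in>{1..b}. adj (U i) u v \<or> {u, v} = {r, c i})"
  by (auto simp: adj_def join_trees_def)

lemma adj_J_component:
  assumes "i \<in> {1..b}" "u \<in> nodes (U i)" "v \<noteq> r" "adj J u v"
  shows "adj (U i) u v"
proof -
  have "u \<noteq> r" using assms root_fresh by auto
  then obtain j where j: "j \<in> {1..b}" "adj (U j) u v"
    using assms by (auto simp: adj_J_iff doubleton_eq_iff)
  then have "u \<in> nodes (U j)" using simple_ugraph_adjD[OF simple] by simp
  then have "i = j" using component_unique[OF assms(2)] j assms(1) by simp
  then show ?thesis using j by simp
qed

text \<open>The only edges at \<open>r\<close> are the added ones, and disjointness leaves just one
  of them for each component. So \<open>c i\<close> is the only gate between \<open>U i\<close> and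
  the rest.\<close>

lemma adj_J_root:
  assumes "i \<in> {1..b}" "u \<in> nodes (U i)" "adj J u r"
  shows "u = c i"
proof -
  have "u \<noteq> r" using assms root_fresh by auto
  moreover have "\<not> adj (U j) u r" if "j \<in> {1..b}" for j
    using simple_ugraph_adjD[OF simple[OF that]] root_fresh[OF that] by blast
  ultimately obtain j where j: "j \<in> {1..b}" "u = c j"
    using assms by (auto simp: adj_J_iff doubleton_eq_iff)
  then have "i = j" using component_unique[OF assms(2)] attach[of j] assms(1) by simp
  with j show ?thesis by simp
qed

text \<open>Every edge that leaves a component ends in \<open>r\<close>, so membership in
  \<open>nodes (U i)\<close> is constant along a walk that avoids \<open>r\<close>.\<close>

lemma rootless_walk_in_component:
  assumes "i \<in> {1..b}" "successively (adj J) p" "r \<notin> set p" "x \<in> set p" "x \<in> nodes (U i)"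
  shows "set p \<subseteq> nodes (U i)"
proof
  fix y assume "y \<in> set p"
  have "u \<in> nodes (U i) \<longleftrightarrow> v \<in> nodes (U i)" if "u \<in> set p" "v \<in> set p" "adj J u v" for u v
    using that adj_J_component[OF assms(1), of u v] adj_J_component[OF assms(1), of v u]
      simple_ugraph_adjD[OF simple[OF assms(1)]] assms(3) adj_sym by metis
  from successively_invariant[OF assms(2), where A = "\<lambda>u. u \<in> nodes (U i)", OF this assms(4) \<open>y \<in> set p\<close>]
  show "y \<in> nodes (U i)" using assms(5) by blast
qed

text \<open>Split such a path at \<open>r\<close>. Both halves avoid \<open>r\<close> and contain a
  node of \<open>U i\<close>, hence stay in \<open>U i\<close>; so the path would leave and re-enter
  through the same gate \<open>c i\<close>, against distinctness.\<close>

lemma root_not_on_component_path: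
  assumes i: "i \<in> {1..b}" and uv: "u \<in> nodes (U i)" "v \<in> nodes (U i)" and p: "is_path J u p v"
  shows "r \<notin> set p"
proof
  assume "r \<in> set p"
  then obtain p1 p2 where p_eq: "p = p1 @ r # p2" by (meson split_list)
  have "u \<noteq> r" "v \<noteq> r" using uv root_fresh i by auto
  then have ne: "p1 \<noteq> []" "p2 \<noteq> []"
    using p p_eq by (auto simp: is_path_def)
  have succ: "successively (adj J) p1" "successively (adj J) p2"
      "adj J (last p1) r" "adj J r (hd p2)"
    using p ne by (auto simp: is_path_def p_eq successively_append_iff successively_Cons)
  have dist: "r \<notin> set p1" "r \<notin> set p2" "set p1 \<inter> set p2 = {}"
    using p by (auto simp: is_path_def p_eq)
  have "u \<in> set p1" "v \<in> set p2"
    using p ne by (auto simp: is_path_def p_eq)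
  then have "set p1 \<subseteq> nodes (U i)" "set p2 \<subseteq> nodes (U i)"
    using rootless_walk_in_component[OF i] succ dist uv by metis+
  then have "last p1 = c i" "hd p2 = c i"
    using adj_J_root[OF i] succ ne adj_sym by (metis hd_in_set last_in_set subsetD)+
  then show False
    using dist(3) ne by (metis disjoint_iff hd_in_set last_in_set)
qed

lemma is_path_component_iff:
  assumes i: "i \<in> {1..b}" and uv: "u \<in> nodes (U i)" "v \<in> nodes (U i)"
  shows "is_path J u p v \<longleftrightarrow> is_path (U i) u p v"
proof
  assume p: "is_path J u p v"
  have r: "r \<notin> set p" by (rule root_not_on_component_path[OF i uv p])
  have "u \<in> set p" "successively (adj J) p" using p by (auto simp: is_path_def)
  then have sub: "set p \<subseteq> nodes (U i)"
    using rootless_walk_in_component[OF i _ r] uv by blast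
  have "adj (U i) x y" if "x \<in> set p" "y \<in> set p" "adj J x y" for x y
    by (rule adj_J_component[OF i]) (use sub r that in auto)
  then have "successively (adj (U i)) p"
    by (rule successively_mono[OF \<open>successively (adj J) p\<close>])
  with p sub show "is_path (U i) u p v" by (simp add: is_path_def)
next
  assume p: "is_path (U i) u p v"
  then have "successively (adj (U i)) p" by (simp add: is_path_def)
  then have "successively (adj J) p"
    by (rule successively_mono) (use i in \<open>auto simp: adj_J_iff\<close>)
  with p i show "is_path J u p v" by (auto simp: is_path_def nodes_J)
qed

text \<open>Since paths between nodes of one component are the same in both graphs, such a pair has
  the same \<open>Z\<close> variables and the same covering sum in the two LPs.\<close>

lemma path_between_component:
  "i \<in> {1..b} \<Longrightarrow> u \<in> nodes (U i) \<Longrightarrow> v \<in> nodes (U i) \<Longrightarrow>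
    path_between J u v = path_between (U i) u v"
  by (simp add: path_between_def is_path_component_iff)

text \<open>Walk to the gate \<open>c i\<close>, cross \<open>r\<close>, and go on from
  \<open>c j\<close>; disjointness keeps the concatenation a path. Hence
  \<open>Zvar r {u, v}\<close> is a variable of the LP for \<open>J\<close> and can cover the
  pair.\<close>

lemma root_between_components:
  assumes ij: "i \<in> {1..b}" "j \<in> {1..b}" "i \<noteq> j" and uv: "u \<in> nodes (U i)" "v \<in> nodes (U j)"
  shows "r \<in> path_between J u v"
proof -
  obtain p where p: "is_path (U i) u p (c i)"
    using connected[OF ij(1)] attach[OF ij(1)] uv(1) by (auto simp: connected_ugraph_def)
  obtain q where q: "is_path (U j) (c j) q v"
    using connected[OF ij(2)] attach[OF ij(2)] uv(2) by (auto simp: connected_ugraph_def)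
  have p': "is_path J u p (c i)"
    using p is_path_component_iff[OF ij(1) uv(1) attach[OF ij(1)]] by simp
  have q': "is_path J (c j) q v"
    using q is_path_component_iff[OF ij(2) attach[OF ij(2)] uv(2)] by simp
  have "set p \<subseteq> nodes (U i)" "set q \<subseteq> nodes (U j)"
    using p q by (auto simp: is_path_def)
  moreover from this have "set p \<inter> set q = {}"
    using component_unique[OF _ _ ij(1,2)] ij(3) by blast
  moreover have "adj J (c i) r" "adj J r (c j)"
    using ij unfolding adj_J_iff by blast+
  ultimately have "is_path J u (p @ r # q) v"
    using p' q' root_fresh ij
    by (auto simp: is_path_def nodes_J successively_append_iff successively_Cons)
  then show ?thesis
    using root_fresh[OF ij(1)] root_fresh[OF ij(2)] uv unfolding path_between_def
    by (auto intro!: exI[of _ "p @ r # q"])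
qed

section \<open>Variables of the join and coordinates of the glued point\<close>

lemma stt_vars_component_subset: "i \<in> {1..b} \<Longrightarrow> stt_vars (U i) \<subseteq> stt_vars J"
proof
  fix x assume i: "i \<in> {1..b}" and x: "x \<in> stt_vars (U i)"
  show "x \<in> stt_vars J"
  proof (cases x)
    case (Zvar k e)
    with x obtain u v where "e = {u, v}" "u \<in> nodes (U i)" "v \<in> nodes (U i)" "u \<noteq> v"
        "k \<in> path_between (U i) u v"
      by (auto elim: Zvar_in_stt_varsE)
    moreover from this have "k \<in> path_between J u v" "u \<in> nodes J" "v \<in> nodes J"
      using i by (simp_all add: path_between_component component_node)
    ultimately show ?thesis using Zvar by (simp add: Zvar_in_stt_vars)
  qed (use x i in \<open>auto simp: nodes_J\<close>)
qed

lemma stt_vars_component_unique: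
  assumes "x \<in> stt_vars (U i)" "x \<in> stt_vars (U j)" "i \<in> {1..b}" "j \<in> {1..b}"
  shows "i = j"
proof -
  have "\<exists>v. v \<in> nodes (U i) \<and> v \<in> nodes (U j)"
  proof (cases x)
    case (Zvar k e)
    then show ?thesis
      using assms(1,2) Zvar_in_stt_vars_subset[of k e] by blast
  qed (use assms(1,2) in auto)
  then show ?thesis using component_unique[OF _ _ assms(3,4)] by blast
qed

text \<open>The coordinates raised by 1 when \<open>r\<close> becomes the root of a search tree.
  Reading \<open>Xvar u v\<close> as "\<open>u\<close> is an ancestor of \<open>v\<close>", the root
  is an ancestor of all other nodes, adds 1 to their depths, and separates every pair from different
  components.\<close>

definition root_vars :: "'a stt_var set" where
  "root_vars = {Dvar v | v. v \<in> nodes J - {r}} \<union> {Xvar r v | v. v \<in> nodes J - {r}} \<union>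
     {Zvar r {u, v} | u v. \<exists>i\<in>{1..b}. \<exists>j\<in>{1..b}. i \<noteq> j \<and> u \<in> nodes (U i) \<and> v \<in> nodes (U j)}"

lemma root_vars_subset: "root_vars \<subseteq> stt_vars J"
proof
  fix x assume "x \<in> root_vars"
  then consider v where "x = Dvar v" "v \<in> nodes J - {r}" | v where "x = Xvar r v" "v \<in> nodes J - {r}"
    | u v i j where "x = Zvar r {u, v}" "i \<in> {1..b}" "j \<in> {1..b}" "i \<noteq> j"
        "u \<in> nodes (U i)" "v \<in> nodes (U j)"
    unfolding root_vars_def by blast
  then show "x \<in> stt_vars J"
  proof cases
    case (3 u v i j)
    have "u \<noteq> v" using component_unique[of u i j] 3 by auto
    moreover have "r \<in> path_between J u v" using root_between_components 3 by blast
    moreover have "u \<in> nodes J" "v \<in> nodes J" using 3 by (auto simp: nodes_J)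
    ultimately show ?thesis using 3(1) by (simp add: Zvar_in_stt_vars)
  qed (auto simp: nodes_J)
qed

lemma finite_root_vars: "finite root_vars"
  using root_vars_subset finite_stt_vars[OF finite_nodes_J] by (rule finite_subset)

text \<open>When each \<open>Q i\<close> is supported on \<open>stt_vars (U i)\<close>, the summands
  have disjoint supports, so the sum merely places the points side by side before the shift is
  added.\<close>

definition glue :: "(nat \<Rightarrow> ('a stt_var, real) poly_mapping) \<Rightarrow> ('a stt_var, real) poly_mapping" where
  "glue Q = (\<Sum>i\<in>{1..b}. Q i) + pm_on root_vars (\<lambda>_. 1)"

text \<open>The \<open>X\<close> and \<open>Z\<close> variables of the shift have \<open>r\<close>
  as first index, and \<open>r\<close> lies in no component. So the shift meets a component only in
  its depth variables and leaves the coordinates to be projected intact.\<close>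

lemma root_vars_component:
  assumes "i \<in> {1..b}" "x \<in> stt_vars (U i)"
  shows "x \<in> root_vars \<longleftrightarrow> x \<in> range Dvar"
proof (cases x)
  case (Dvar v)
  then show ?thesis
    using assms root_fresh[OF assms(1)] component_node[OF assms(1)] by (auto simp: root_vars_def)
next
  case (Xvar u v)
  then show ?thesis
    using assms root_fresh[OF assms(1)] by (auto simp: root_vars_def)
next
  case (Zvar k e)
  then have "k \<in> nodes (U i)"
    using assms(2) Zvar_in_stt_vars_subset(1)[of k e "U i"] by simp
  then show ?thesis
    using Zvar root_fresh[OF assms(1)] by (auto simp: root_vars_def)
qed

lemma root_notin_component_vars:
  assumes "i \<in> {1..b}"
  shows "Dvar r \<notin> stt_vars (U i)" "Xvar r v \<notin> stt_vars (U i)" "Xvar v r \<notin> stt_vars (U i)"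
    "Zvar r e \<notin> stt_vars (U i)" "r \<in> e \<Longrightarrow> Zvar k e \<notin> stt_vars (U i)"
  using root_fresh[OF assms] Zvar_in_stt_vars_subset(1)[of r e "U i"]
    Zvar_in_stt_vars_subset(2)[of k e "U i"] by auto

lemma cross_notin_component_vars:
  assumes "i \<in> {1..b}" "j \<in> {1..b}" "i \<noteq> j" "u \<in> nodes (U i)" "v \<in> nodes (U j)" "l \<in> {1..b}"
  shows "Xvar u v \<notin> stt_vars (U l)" "Zvar k {u, v} \<notin> stt_vars (U l)"
proof -
  have "\<not> (u \<in> nodes (U l) \<and> v \<in> nodes (U l))"
    using component_unique[of u i l] component_unique[of v j l] assms by blast
  then show "Xvar u v \<notin> stt_vars (U l)" "Zvar k {u, v} \<notin> stt_vars (U l)"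
    using Zvar_in_stt_vars_subset(2)[of k "{u, v}" "U l"] by auto
qed

lemma lookup_glue:
  "Poly_Mapping.lookup (glue Q) x =
     (\<Sum>i\<in>{1..b}. Poly_Mapping.lookup (Q i) x) + (if x \<in> root_vars then 1 else 0)"
  by (simp add: glue_def lookup_add lookup_sum lookup_pm_on finite_root_vars)

lemma lookup_glue_component:
  assumes keys: "\<forall>i\<in>{1..b}. Poly_Mapping.keys (Q i) \<subseteq> stt_vars (U i)"
    and i: "i \<in> {1..b}" and x: "x \<in> stt_vars (U i)"
  shows "Poly_Mapping.lookup (glue Q) x =
    Poly_Mapping.lookup (Q i) x + (if x \<in> range Dvar then 1 else 0)"
proof -
  have "Poly_Mapping.lookup (Q j) x = 0" if "j \<in> {1..b} - {i}" for j
    using that bspec[OF keys, of j] stt_vars_component_unique[OF x _ i, of j]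
    by (auto simp: keys_subset_iff)
  then have "(\<Sum>j\<in>{1..b}. Poly_Mapping.lookup (Q j) x) = Poly_Mapping.lookup (Q i) x"
    using i by (subst sum.remove[of _ i]) auto
  then show ?thesis
    by (simp add: lookup_glue root_vars_component[OF i x])
qed

lemma lookup_glue_outside:
  assumes keys: "\<forall>i\<in>{1..b}. Poly_Mapping.keys (Q i) \<subseteq> stt_vars (U i)"
    and x: "\<And>i. i \<in> {1..b} \<Longrightarrow> x \<notin> stt_vars (U i)"
  shows "Poly_Mapping.lookup (glue Q) x = (if x \<in> root_vars then 1 else 0)"
proof -
  have "Poly_Mapping.lookup (Q i) x = 0" if "i \<in> {1..b}" for i
    using bspec[OF keys that] x[OF that] by (auto simp: keys_subset_iff)
  then show ?thesis by (simp add: lookup_glue)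
qed

lemma root_vars_iff:
  "Dvar v \<in> root_vars \<longleftrightarrow> v \<in> nodes J - {r}"
  "Xvar u v \<in> root_vars \<longleftrightarrow> u = r \<and> v \<in> nodes J - {r}"
  "Zvar k e \<in> root_vars \<longleftrightarrow> k = r \<and>
     (\<exists>u v. \<exists>i\<in>{1..b}. \<exists>j\<in>{1..b}. e = {u, v} \<and> i \<noteq> j \<and> u \<in> nodes (U i) \<and> v \<in> nodes (U j))"
  by (auto simp: root_vars_def)

text \<open>The feasibility proof and the rigidity proof both follow these four positions of a
  pair.\<close>

lemma node_pair_cases [consumes 3, case_names root_left root_right same cross]:
  assumes "u \<in> nodes J" "v \<in> nodes J" "u \<noteq> v"
  obtains "u = r" "v \<in> nodes J - {r}"
  | "v = r" "u \<in> nodes J - {r}"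
  | i where "i \<in> {1..b}" "u \<in> nodes (U i)" "v \<in> nodes (U i)"
  | i j where "i \<in> {1..b}" "j \<in> {1..b}" "i \<noteq> j" "u \<in> nodes (U i)" "v \<in> nodes (U j)"
  using assms unfolding nodes_J by (cases "u = r"; cases "v = r") blast+

lemma lookup_glue_root:
  assumes keys: "\<forall>i\<in>{1..b}. Poly_Mapping.keys (Q i) \<subseteq> stt_vars (U i)"
  shows "Poly_Mapping.lookup (glue Q) (Dvar r) = 0"
    and "v \<in> nodes J - {r} \<Longrightarrow> Poly_Mapping.lookup (glue Q) (Xvar r v) = 1"
    and "Poly_Mapping.lookup (glue Q) (Xvar v r) = 0"
    and "r \<in> e \<Longrightarrow> Poly_Mapping.lookup (glue Q) (Zvar k e) = 0"
proof -
  note outside = lookup_glue_outside[where Q = Q, OF keys]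
  show "Poly_Mapping.lookup (glue Q) (Dvar r) = 0"
    by (subst outside) (auto simp: root_notin_component_vars root_vars_iff simp del: stt_vars_iff)
  show "Poly_Mapping.lookup (glue Q) (Xvar r v) = 1" if "v \<in> nodes J - {r}"
    using that
    by (subst outside) (auto simp: root_notin_component_vars root_vars_iff simp del: stt_vars_iff)
  show "Poly_Mapping.lookup (glue Q) (Xvar v r) = 0"
    by (subst outside) (auto simp: root_notin_component_vars root_vars_iff simp del: stt_vars_iff)
  show "Poly_Mapping.lookup (glue Q) (Zvar k e) = 0" if "r \<in> e"
    using that root_fresh
    by (subst outside) (auto simp: root_notin_component_vars root_vars_iff simp del: stt_vars_iff)
qed

lemma lookup_glue_cross:
  assumes keys: "\<forall>i\<in>{1..b}. Poly_Mapping.keys (Q i) \<subseteq> stt_vars (U i)"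
    and ij: "i \<in> {1..b}" "j \<in> {1..b}" "i \<noteq> j" "u \<in> nodes (U i)" "v \<in> nodes (U j)"
  shows "Poly_Mapping.lookup (glue Q) (Xvar u v) = 0"
    and "Poly_Mapping.lookup (glue Q) (Zvar k {u, v}) = (if k = r then 1 else 0)"
proof -
  note outside = lookup_glue_outside[where Q = Q, OF keys]
  note cross = cross_notin_component_vars[OF ij]
  show "Poly_Mapping.lookup (glue Q) (Xvar u v) = 0"
    using ij root_fresh by (subst outside) (auto simp: cross root_vars_iff simp del: stt_vars_iff)
  have "Zvar k {u, v} \<in> root_vars \<longleftrightarrow> k = r"
    using ij unfolding root_vars_iff by blast
  then show "Poly_Mapping.lookup (glue Q) (Zvar k {u, v}) = (if k = r then 1 else 0)"
    by (subst outside) (simp_all add: cross)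
qed

lemma lookup_glue_same:
  assumes keys: "\<forall>i\<in>{1..b}. Poly_Mapping.keys (Q i) \<subseteq> stt_vars (U i)"
    and i: "i \<in> {1..b}" "u \<in> nodes (U i)"
  shows "Poly_Mapping.lookup (glue Q) (Dvar u) = Poly_Mapping.lookup (Q i) (Dvar u) + 1"
    and "v \<in> nodes (U i) \<Longrightarrow> u \<noteq> v \<Longrightarrow>
      Poly_Mapping.lookup (glue Q) (Xvar u v) = Poly_Mapping.lookup (Q i) (Xvar u v)"
    and "v \<in> nodes (U i) \<Longrightarrow> u \<noteq> v \<Longrightarrow> k \<in> path_between (U i) u v \<Longrightarrow>
      Poly_Mapping.lookup (glue Q) (Zvar k {u, v}) = Poly_Mapping.lookup (Q i) (Zvar k {u, v})"
proof -
  note inside = lookup_glue_component[where Q = Q, OF keys i(1)]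
  show "Poly_Mapping.lookup (glue Q) (Dvar u) = Poly_Mapping.lookup (Q i) (Dvar u) + 1"
    using i by (subst inside) auto
  show "Poly_Mapping.lookup (glue Q) (Xvar u v) = Poly_Mapping.lookup (Q i) (Xvar u v)"
    if "v \<in> nodes (U i)" "u \<noteq> v"
    using that i by (subst inside) auto
  show "Poly_Mapping.lookup (glue Q) (Zvar k {u, v}) = Poly_Mapping.lookup (Q i) (Zvar k {u, v})"
    if "v \<in> nodes (U i)" "u \<noteq> v" "k \<in> path_between (U i) u v"
    using that i by (subst inside) (auto intro: Zvar_in_stt_vars)
qed

section \<open>Feasibility of glued and of restricted points\<close>

lemma sum_path_between_root:
  fixes f :: "'a \<Rightarrow> real"
  assumes "\<And>k. k \<in> path_between J u v \<Longrightarrow> f k = (if k = r then 1 else 0)" "r \<in> path_between J u v"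
  shows "sum f (path_between J u v) = 1"
  using assms sum.cong[OF refl assms(1)] finite_path_between[OF finite_nodes_J, of u v] by simp

text \<open>Splits the lower bound on the depth of \<open>v\<close> into the contributions of its
  own component, of the root and of the other components. In the glued point the last two are 1 and
  0.\<close>

lemma sum_other_nodes_component:
  fixes f :: "'a \<Rightarrow> real"
  assumes "i \<in> {1..b}" "v \<in> nodes (U i)"
  shows "(\<Sum>u\<in>nodes J - {v}. f u) =
    (\<Sum>u\<in>nodes (U i) - {v}. f u) + f r + (\<Sum>u\<in>nodes J - insert r (nodes (U i)). f u)"
proof -
  have "nodes J - {v} =
      (nodes (U i) - {v}) \<union> (insert r (nodes J - insert r (nodes (U i))))"
    using assms root_fresh by (auto simp: nodes_J)
  moreover have "(nodes (U i) - {v}) \<inter> insert r (nodes J - insert r (nodes (U i))) = {}"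
    using root_fresh assms by auto
  ultimately show ?thesis
    using finite_nodes_J finite_nodes_component[OF assms(1)]
    by (simp add: sum.union_disjoint)
qed

text \<open>A pair inside a component inherits the constraints of \<open>U i\<close>. A pair with
  \<open>r\<close> is covered by \<open>Xvar r v\<close>, and a pair from two components by
  \<open>Zvar r {u, v}\<close>, which the value 1 of \<open>Xvar r u\<close> and
  \<open>Xvar r v\<close> permits.\<close>

lemma glue_in_polyhedron:
  assumes Q: "\<And>i. i \<in> {1..b} \<Longrightarrow> Q i \<in> stt_polyhedron (U i)"
  shows "glue Q \<in> stt_polyhedron J"
proof -
  have keys: "\<forall>i\<in>{1..b}. Poly_Mapping.keys (Q i) \<subseteq> stt_vars (U i)"
    by (intro ballI stt_polyhedronD(1) Q)
  note root = lookup_glue_root[where Q = Q, OF keys, simplified]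
    and same_D = lookup_glue_same(1)[where Q = Q, OF keys]
    and same_X = lookup_glue_same(2)[where Q = Q, OF keys]
    and same_Z = lookup_glue_same(3)[where Q = Q, OF keys]
    and cross_X = lookup_glue_cross(1)[where Q = Q, OF keys]
    and cross_Z = lookup_glue_cross(2)[where Q = Q, OF keys]
  let ?P = "Poly_Mapping.lookup (glue Q)"
  have "Poly_Mapping.keys (glue Q) \<subseteq> stt_vars J"
    unfolding keys_subset_iff
  proof (intro allI impI)
    fix x assume "x \<notin> stt_vars J"
    then have "x \<notin> stt_vars (U i)" if "i \<in> {1..b}" for i
      using stt_vars_component_subset[OF that] by blast
    then have "?P x = (if x \<in> root_vars then 1 else 0)"
      by (rule lookup_glue_outside[OF keys])
    then show "?P x = 0"
      using \<open>x \<notin> stt_vars J\<close> root_vars_subset by auto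
  qed
  moreover have X_nonneg: "0 \<le> ?P (Xvar u v)"
    if uv: "u \<in> nodes J" "v \<in> nodes J" "u \<noteq> v" for u v
    using uv
  proof (cases rule: node_pair_cases)
    case (same i)
    then show ?thesis using same_X[of i u v] stt_polyhedronD(3)[OF Q[of i], of u v] uv by simp
  next
    case (cross i j)
    then show ?thesis using cross_X[OF cross] by simp
  qed (simp_all add: root)
  moreover have "1 \<le> ?P (Xvar u v) + ?P (Xvar v u) + (\<Sum>k\<in>path_between J u v. ?P (Zvar k {u, v}))"
    if uv: "u \<in> nodes J" "v \<in> nodes J" "u \<noteq> v" for u v
    using uv
  proof (cases rule: node_pair_cases)
    case (same i)
    have "(\<Sum>k\<in>path_between J u v. ?P (Zvar k {u, v})) =
        (\<Sum>k\<in>path_between (U i) u v. Poly_Mapping.lookup (Q i) (Zvar k {u, v}))"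
      using path_between_component[OF same] same_Z[OF same(1,2,3) uv(3)] by simp
    then show ?thesis
      using same_X[OF same(1,2,3)] same_X[OF same(1,3,2)] uv
        stt_polyhedronD(4)[OF Q[OF same(1)] same(2,3)] by simp
  next
    case (cross i j)
    have "(\<Sum>k\<in>path_between J u v. ?P (Zvar k {u, v})) = 1"
      using cross_Z[OF cross] root_between_components[OF cross]
      by (intro sum_path_between_root) auto
    then show ?thesis
      using cross_X[OF cross] cross_X[OF cross(2,1) cross(3)[symmetric] cross(5,4)] by simp
  qed (simp_all add: root)
  moreover have "0 \<le> ?P (Zvar k {u, v}) \<and>
      ?P (Zvar k {u, v}) \<le> ?P (Xvar k u) \<and> ?P (Zvar k {u, v}) \<le> ?P (Xvar k v)"
    if uv: "u \<in> nodes J" "v \<in> nodes J" "u \<noteq> v" and k: "k \<in> path_between J u v" for u v k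
  proof -
    have k': "k \<in> nodes J" "k \<noteq> u" "k \<noteq> v"
      using k path_between_subset_nodes[of J u v] by (auto simp: path_between_def)
    have nonneg: "0 \<le> ?P (Xvar k u)" "0 \<le> ?P (Xvar k v)"
      using X_nonneg k' uv by simp_all
    show ?thesis
      using uv
    proof (cases rule: node_pair_cases)
      case (same i)
      have kU: "k \<in> path_between (U i) u v" "k \<in> nodes (U i)"
        using k path_between_component[OF same] path_between_subset_nodes[of "U i" u v] by auto
      show ?thesis
        using same_Z[OF same uv(3) kU(1)] same_X[OF same(1) kU(2) same(2) k'(2)]
          same_X[OF same(1) kU(2) same(3) k'(3)]
          stt_polyhedronD(5-7)[OF Q[OF same(1)] same(2,3) uv(3) kU(1)] by simp
    next
      case (cross i j)
      then have "u \<noteq> r" "v \<noteq> r" using root_fresh by auto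
      then show ?thesis
        using cross_Z[OF cross, of k] nonneg root(2) uv by simp
    qed (use nonneg in \<open>simp_all add: root\<close>)
  qed
  moreover have "(\<Sum>u\<in>nodes J - {v}. ?P (Xvar u v)) \<le> ?P (Dvar v)" if vJ: "v \<in> nodes J" for v
  proof (cases "v = r")
    case True
    then show ?thesis by (simp add: root)
  next
    case False
    then obtain i where i: "i \<in> {1..b}" "v \<in> nodes (U i)"
      using vJ by (auto simp: nodes_J)
    \<comment> \<open>Other components contribute nothing, so the root's contribution is the only
      addition to the sum; raising the depth of \<open>v\<close> by 1 pays for it exactly.\<close>
    have "?P (Xvar u v) = 0" if "u \<in> nodes J - insert r (nodes (U i))" for u
    proof -
      obtain j where "j \<in> {1..b}" "u \<in> nodes (U j)"
        using \<open>u \<in> nodes J - insert r (nodes (U i))\<close> by (auto simp: nodes_J)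
      with i that show ?thesis using cross_X[of j i u v] by auto
    qed
    moreover have "?P (Xvar u v) = Poly_Mapping.lookup (Q i) (Xvar u v)"
      if "u \<in> nodes (U i) - {v}" for u
      using that i same_X[of i u v] by simp
    ultimately have "(\<Sum>u\<in>nodes J - {v}. ?P (Xvar u v)) =
        (\<Sum>u\<in>nodes (U i) - {v}. Poly_Mapping.lookup (Q i) (Xvar u v)) + 1"
      using i vJ False by (simp add: sum_other_nodes_component[OF i] root)
    then show ?thesis
      using stt_polyhedronD(2)[OF Q[OF i(1)] i(2)] same_D[OF i] by simp
  qed
  ultimately show ?thesis
    by (simp add: stt_polyhedron_def)
qed

text \<open>A converse to gluing, to be applied to the endpoints of a segment through the glued
  point. The \<open>X\<close> and \<open>Z\<close> constraints carry over because the path sets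
  agree; only the depth constraints change.\<close>

lemma restriction_in_polyhedron:
  assumes A: "A \<in> stt_polyhedron J" and i: "i \<in> {1..b}"
    and root: "\<And>v. v \<in> nodes (U i) \<Longrightarrow> 1 \<le> Poly_Mapping.lookup A (Xvar r v)"
  shows "pm_on (stt_vars (U i)) (\<lambda>x. Poly_Mapping.lookup A x - (if x \<in> range Dvar then 1 else 0))
    \<in> stt_polyhedron (U i)" (is "?R \<in> _")
proof -
  let ?a = "Poly_Mapping.lookup A"
  have lookup_R: "Poly_Mapping.lookup ?R x =
      (if x \<in> stt_vars (U i) then ?a x - (if x \<in> range Dvar then 1 else 0) else 0)" for x
    by (rule lookup_pm_on[OF finite_stt_vars[OF finite_nodes_component[OF i]]])
  have D: "Poly_Mapping.lookup ?R (Dvar v) = ?a (Dvar v) - 1" if "v \<in> nodes (U i)" for v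
    using that by (simp add: lookup_R)
  have X: "Poly_Mapping.lookup ?R (Xvar u v) = ?a (Xvar u v)"
    if "u \<in> nodes (U i)" "v \<in> nodes (U i)" "u \<noteq> v" for u v
    using that by (auto simp: lookup_R)
  have Z: "Poly_Mapping.lookup ?R (Zvar k {u, v}) = ?a (Zvar k {u, v})"
    if "u \<in> nodes (U i)" "v \<in> nodes (U i)" "u \<noteq> v" "k \<in> path_between (U i) u v" for k u v
    using Zvar_in_stt_vars[OF that] by (auto simp: lookup_R)
  have "Poly_Mapping.keys ?R \<subseteq> stt_vars (U i)"
    unfolding keys_subset_iff lookup_R by simp
  moreover have "0 \<le> Poly_Mapping.lookup ?R (Xvar u v) \<and>
      1 \<le> Poly_Mapping.lookup ?R (Xvar u v) + Poly_Mapping.lookup ?R (Xvar v u)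
        + (\<Sum>k\<in>path_between (U i) u v. Poly_Mapping.lookup ?R (Zvar k {u, v})) \<and>
      (\<forall>k\<in>path_between (U i) u v. 0 \<le> Poly_Mapping.lookup ?R (Zvar k {u, v}) \<and>
        Poly_Mapping.lookup ?R (Zvar k {u, v}) \<le> Poly_Mapping.lookup ?R (Xvar k u) \<and>
        Poly_Mapping.lookup ?R (Zvar k {u, v}) \<le> Poly_Mapping.lookup ?R (Xvar k v))"
    if uv: "u \<in> nodes (U i)" "v \<in> nodes (U i)" "u \<noteq> v" for u v
  proof -
    note uvJ = component_node[OF i uv(1)] component_node[OF i uv(2)] uv(3)
    have path: "path_between J u v = path_between (U i) u v"
      using path_between_component i uv by simp
    have sum: "(\<Sum>k\<in>path_between (U i) u v. Poly_Mapping.lookup ?R (Zvar k {u, v})) =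
        (\<Sum>k\<in>path_between (U i) u v. ?a (Zvar k {u, v}))"
      using Z[OF uv] by simp
    have k: "k \<in> nodes (U i)" "k \<noteq> u" "k \<noteq> v" if "k \<in> path_between (U i) u v" for k
      using that path_between_subset_nodes[of "U i" u v] by (auto simp: path_between_def)
    show ?thesis
      unfolding sum
      using stt_polyhedronD(3-7)[OF A uvJ] X[OF uv] X[OF uv(2,1) uv(3)[symmetric]] Z[OF uv]
        X[OF k(1) uv(1) k(2)] X[OF k(1) uv(2) k(3)]
      by (simp add: path)
  qed
  moreover have "(\<Sum>u\<in>nodes (U i) - {v}. Poly_Mapping.lookup ?R (Xvar u v)) \<le> Poly_Mapping.lookup ?R (Dvar v)"
    if v: "v \<in> nodes (U i)" for v
  proof -
    \<comment> \<open>Dropping the nonnegative terms from other components and moving the root's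
      term, at least 1, to the other side yields the bound for the lowered depth.\<close>
    have "0 \<le> (\<Sum>u\<in>nodes J - insert r (nodes (U i)). ?a (Xvar u v))"
      using v component_node[OF i v] by (intro sum_nonneg stt_polyhedronD(3)[OF A]) auto
    moreover have "(\<Sum>u\<in>nodes J - {v}. ?a (Xvar u v)) \<le> ?a (Dvar v)"
      using stt_polyhedronD(2)[OF A component_node[OF i v]] .
    ultimately have "(\<Sum>u\<in>nodes (U i) - {v}. ?a (Xvar u v)) \<le> ?a (Dvar v) - 1"
      using root[OF v] sum_other_nodes_component[OF i v, of "\<lambda>u. ?a (Xvar u v)"] by linarith
    moreover have "(\<Sum>u\<in>nodes (U i) - {v}. Poly_Mapping.lookup ?R (Xvar u v)) =
        (\<Sum>u\<in>nodes (U i) - {v}. ?a (Xvar u v))"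
      by (rule sum.cong) (use X v in auto)
    ultimately show ?thesis using D[OF v] by simp
  qed
  ultimately show ?thesis
    by (simp add: stt_polyhedron_def)
qed

section \<open>Extremality of the glued point\<close>

lemma glue_extreme_point:
  assumes Q: "\<And>i. i \<in> {1..b} \<Longrightarrow> Q i extreme_point_of stt_polyhedron (U i)"
  shows "glue Q extreme_point_of stt_polyhedron J"
  unfolding extreme_point_of_convex_combination_iff
proof (intro conjI ballI allI impI; (elim conjE)?)
  have Q_in: "Q i \<in> stt_polyhedron (U i)" if "i \<in> {1..b}" for i
    using Q[OF that] by (simp add: extreme_point_of_def)
  then show "glue Q \<in> stt_polyhedron J" by (rule glue_in_polyhedron)
  have keys: "\<forall>i\<in>{1..b}. Poly_Mapping.keys (Q i) \<subseteq> stt_vars (U i)"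
    by (intro ballI stt_polyhedronD(1) Q_in)
  note root = lookup_glue_root[where Q = Q, OF keys, simplified]
    and cross_X = lookup_glue_cross(1)[where Q = Q, OF keys]
    and cross_Z = lookup_glue_cross(2)[where Q = Q, OF keys]
  fix A B t
  assume AB: "A \<in> stt_polyhedron J" "B \<in> stt_polyhedron J"
    and t: "0 < t" "t < (1::real)" and PAB: "glue Q = (1 - t) *\<^sub>R A + t *\<^sub>R B"
  let ?P = "Poly_Mapping.lookup (glue Q)"
    and ?a = "Poly_Mapping.lookup A" and ?b = "Poly_Mapping.lookup B"
  have comb: "(1 - t) * ?a x + t * ?b x = ?P x" for x
    by (simp add: PAB lookup_add)
  \<comment> \<open>A coordinate whose value in the glued point is a lower bound for both endpoints,
    or an upper bound for both, cannot vary along the segment.\<close>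
  have lower: "?a x = ?P x \<and> ?b x = ?P x" if "?P x \<le> ?a x" "?P x \<le> ?b x" for x
    using convex_combination_lower_bound_tight[OF comb t that] by blast
  have upper: "?a x = ?P x \<and> ?b x = ?P x" if "?a x \<le> ?P x" "?b x \<le> ?P x" for x
    using convex_combination_upper_bound_tight[OF comb t that] by blast
  have root_in: "r \<in> nodes J" by (simp add: nodes_J)
  have X_root: "?a (Xvar v r) = 0 \<and> ?b (Xvar v r) = 0" if "v \<in> nodes J - {r}" for v
    using lower[of "Xvar v r"] that stt_polyhedronD(3)[OF AB(1), of v r]
      stt_polyhedronD(3)[OF AB(2), of v r] root_in by (simp add: root)
  have Z_root: "?a (Zvar k {u, v}) = 0 \<and> ?b (Zvar k {u, v}) = 0"
    if "u \<in> nodes J" "v \<in> nodes J" "u \<noteq> v" "k \<in> path_between J u v" "r \<in> {u, v}" for k u v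
    using lower[of "Zvar k {u, v}"] stt_polyhedronD(5)[OF AB(1) that(1-4)]
      stt_polyhedronD(5)[OF AB(2) that(1-4)] root(4)[OF that(5)] by simp
  \<comment> \<open>Once \<open>Xvar v r\<close> and the \<open>Z\<close> variables of the pair
    vanish at both endpoints, the covering constraint forces \<open>Xvar r v\<close> to be at least
    1, which is its value in the glued point.\<close>
  have root_X: "?a (Xvar r v) = 1 \<and> ?b (Xvar r v) = 1" if v: "v \<in> nodes J - {r}" for v
  proof -
    have "r \<noteq> v" using v by blast
    have "1 \<le> ?a (Xvar r v)" "1 \<le> ?b (Xvar r v)"
      using stt_polyhedronD(4)[OF AB(1), of r v] stt_polyhedronD(4)[OF AB(2), of r v]
        X_root[OF v] Z_root[of r v] root_in v \<open>r \<noteq> v\<close> by simp_all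
    then show ?thesis using lower[of "Xvar r v"] v by (simp add: root)
  qed
  have cross_Z_rigid: "?a (Zvar k {u, v}) = ?P (Zvar k {u, v}) \<and> ?b (Zvar k {u, v}) = ?P (Zvar k {u, v})"
    if cross: "i \<in> {1..b}" "j \<in> {1..b}" "i \<noteq> j" "u \<in> nodes (U i)" "v \<in> nodes (U j)"
      and k: "k \<in> path_between J u v" for i j k u v
  proof -
    have uv: "u \<in> nodes J" "v \<in> nodes J" using component_node cross by blast+
    have "u \<noteq> v" using component_unique[of u i j] cross by auto
    have "u \<noteq> r" using root_fresh[of i] cross by auto
    show ?thesis
    proof (cases "k = r")
      case True
      \<comment> \<open>Now \<open>Zvar r {u, v}\<close> is bounded above by
        \<open>Xvar r u\<close>, just shown to be 1, and the glued point attains this bound.\<close>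
      then show ?thesis
        using upper[of "Zvar k {u, v}"] cross_Z[OF cross, of k] root_X[of u] uv \<open>u \<noteq> r\<close>
          stt_polyhedronD(6)[OF AB(1) uv \<open>u \<noteq> v\<close> k] stt_polyhedronD(6)[OF AB(2) uv \<open>u \<noteq> v\<close> k]
        by simp
    next
      case False
      then show ?thesis
        using lower[of "Zvar k {u, v}"] cross_Z[OF cross, of k]
          stt_polyhedronD(5)[OF AB(1) uv \<open>u \<noteq> v\<close> k] stt_polyhedronD(5)[OF AB(2) uv \<open>u \<noteq> v\<close> k]
        by simp
    qed
  qed
  \<comment> \<open>Coordinates owned by no component are all frozen: non-variables of
    \<open>J\<close>, the depth of \<open>r\<close>, and the variables of pairs that contain
    \<open>r\<close> or lie in two components.\<close>
  have rigid: "?a x = ?b x" if out: "\<And>i. i \<in> {1..b} \<Longrightarrow> x \<notin> stt_vars (U i)" for x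
  proof (cases "x \<in> stt_vars J")
    case False
    then show ?thesis
      using stt_polyhedronD(1)[OF AB(1)] stt_polyhedronD(1)[OF AB(2)] by (simp add: keys_subset_iff)
  next
    case True
    show ?thesis
    proof (cases x)
      case (Dvar v)
      then have x: "x = Dvar r"
        using True out by (auto simp: nodes_J)
      \<comment> \<open>With no ancestor left, the depth of \<open>r\<close> is bounded below by 0,
        its glued value.\<close>
      have "(\<Sum>u\<in>nodes J - {r}. ?a (Xvar u r)) = 0" "(\<Sum>u\<in>nodes J - {r}. ?b (Xvar u r)) = 0"
        using X_root by simp_all
      then show ?thesis
        using lower[of x] stt_polyhedronD(2)[OF AB(1) root_in] stt_polyhedronD(2)[OF AB(2) root_in]
        by (simp add: x root)
    next
      case (Xvar u v)
      then have uv: "u \<in> nodes J" "v \<in> nodes J" "u \<noteq> v" using True by auto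
      then show ?thesis
      proof (cases rule: node_pair_cases)
        case (same i)
        then show ?thesis using out[OF same(1)] Xvar uv by simp
      next
        case (cross i j)
        then show ?thesis
          using lower[of x] cross_X[OF cross] stt_polyhedronD(3)[OF AB(1) uv]
            stt_polyhedronD(3)[OF AB(2) uv] Xvar by simp
      qed (use Xvar X_root root_X in simp_all)
    next
      case (Zvar k e)
      then obtain u v where e: "e = {u, v}" and uv: "u \<in> nodes J" "v \<in> nodes J" "u \<noteq> v"
        and k: "k \<in> path_between J u v"
        using True by (auto elim: Zvar_in_stt_varsE)
      from uv show ?thesis
      proof (cases rule: node_pair_cases)
        case (same i)
        have "Zvar k {u, v} \<in> stt_vars (U i)"
          using k path_between_component[OF same] Zvar_in_stt_vars[OF same(2,3) uv(3)] by simp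
        then show ?thesis using out[OF same(1)] Zvar e by simp
      next
        case (cross i j)
        then show ?thesis using cross_Z_rigid[OF cross k] Zvar e by simp
      qed (use Z_root[OF uv k] Zvar e in simp_all)
    qed
  qed
  \<comment> \<open>On a component, undoing the shift at both endpoints writes \<open>Q i\<close> as
    a combination of two feasible points with the same weight \<open>t\<close>, so extremality of
    \<open>Q i\<close> makes these points equal.\<close>
  have inside: "?a x = ?b x" if i: "i \<in> {1..b}" and x: "x \<in> stt_vars (U i)" for i x
  proof -
    let ?R = "\<lambda>C. pm_on (stt_vars (U i))
      (\<lambda>x. Poly_Mapping.lookup C x - (if x \<in> range Dvar then 1 else 0))"
    have lookup_R: "Poly_Mapping.lookup (?R C) x =
        (if x \<in> stt_vars (U i) then Poly_Mapping.lookup C x - (if x \<in> range Dvar then 1 else 0) else 0)"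
      for C x
      by (rule lookup_pm_on[OF finite_stt_vars[OF finite_nodes_component[OF i]]])
    have node: "v \<in> nodes J - {r}" if "v \<in> nodes (U i)" for v
      using that component_node[OF i] root_fresh[OF i] by auto
    have "?R A \<in> stt_polyhedron (U i)" "?R B \<in> stt_polyhedron (U i)"
      using AB root_X[OF node] by (simp_all add: restriction_in_polyhedron[OF _ i])
    moreover have "Q i = (1 - t) *\<^sub>R ?R A + t *\<^sub>R ?R B"
    proof (rule poly_mapping_eqI)
      fix y
      show "Poly_Mapping.lookup (Q i) y = Poly_Mapping.lookup ((1 - t) *\<^sub>R ?R A + t *\<^sub>R ?R B) y"
      proof (cases "y \<in> stt_vars (U i)")
        case True
        have "?P y = Poly_Mapping.lookup (Q i) y + (if y \<in> range Dvar then 1 else 0)"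
          by (rule lookup_glue_component[OF keys i True])
        \<comment> \<open>Since the weights add up to 1, subtracting the shift from both endpoints
          subtracts it once from the combination.\<close>
        with comb[of y] True show ?thesis
          unfolding lookup_add lookup_scaleR lookup_R by (simp add: algebra_simps)
      next
        case False
        then show ?thesis
          using bspec[OF keys i] by (simp add: lookup_add lookup_R keys_subset_iff)
      qed
    qed
    ultimately have "?R A = ?R B"
      using Q[OF i] t unfolding extreme_point_of_convex_combination_iff by blast
    then have "Poly_Mapping.lookup (?R A) x = Poly_Mapping.lookup (?R B) x" by simp
    with x show ?thesis by (simp add: lookup_R)
  qed
  show "A = B"
    by (rule poly_mapping_eqI) (use rigid inside in blast)
qed

end

section \<open>A vertex of the joined LP with prescribed projections\<close>

theorem theorem3p14:
  fixes b :: nat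
    and U :: "nat \<Rightarrow> 'a ugraph"
    and r :: 'a
    and c :: "nat \<Rightarrow> 'a"
    and Q :: "nat \<Rightarrow> ('a stt_var, real) poly_mapping"
  assumes "b \<ge> 2"
    and "\<And>i. i \<in> {1..b} \<Longrightarrow> is_tree (U i)"
    and "disjoint_family_on (\<lambda>i. nodes (U i)) {1..b}"
    and "\<And>i. i \<in> {1..b} \<Longrightarrow> r \<notin> nodes (U i)"
    and "\<And>i. i \<in> {1..b} \<Longrightarrow> c i \<in> nodes (U i)"
    and "\<And>i. i \<in> {1..b} \<Longrightarrow> Q i extreme_point_of stt_polyhedron (U i)"
  shows "\<exists>P. P extreme_point_of stt_polyhedron (join_trees r b U c) \<and>
           (\<forall>i\<in>{1..b}. \<forall>u\<in>nodes (U i). \<forall>v\<in>nodes (U i). u \<noteq> v \<longrightarrow>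
              Poly_Mapping.lookup P (Xvar u v) = Poly_Mapping.lookup (Q i) (Xvar u v) \<and>
              (\<forall>k\<in>nodes (U i) \<inter> path_between (join_trees r b U c) u v.
                 Poly_Mapping.lookup P (Zvar k {u, v}) = Poly_Mapping.lookup (Q i) (Zvar k {u, v})))"
proof -
  interpret tree_join r b U c
    using assms(2-5) by unfold_locales (auto simp: is_tree_def)
  have keys: "\<forall>i\<in>{1..b}. Poly_Mapping.keys (Q i) \<subseteq> stt_vars (U i)"
    using assms(6) by (simp add: extreme_point_of_def stt_polyhedronD(1))
  show ?thesis
  proof (intro exI conjI ballI impI)
    show "glue Q extreme_point_of stt_polyhedron J"
      using assms(6) by (rule glue_extreme_point)
  next
    fix i u v
    assume uv: "i \<in> {1..b}" "u \<in> nodes (U i)" "v \<in> nodes (U i)" "u \<noteq> v"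
    show "Poly_Mapping.lookup (glue Q) (Xvar u v) = Poly_Mapping.lookup (Q i) (Xvar u v)"
      by (rule lookup_glue_same(2)[OF keys uv])
    fix k assume "k \<in> nodes (U i) \<inter> path_between J u v"
    \<comment> \<open>The path set in the join is that of \<open>U i\<close>, so \<open>k\<close>
      indexes a \<open>Z\<close> variable of the component, untouched by the shift.\<close>
    then have k: "k \<in> path_between (U i) u v"
      using path_between_component[OF uv(1-3)] by simp
    show "Poly_Mapping.lookup (glue Q) (Zvar k {u, v}) = Poly_Mapping.lookup (Q i) (Zvar k {u, v})"
      by (rule lookup_glue_same(3)[OF keys uv k])
  qed
qed

end
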